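(* Not all Furstenberg domains are quasi-atomic; that is, there exists an integral domain that is Furstenberg but not quasi-atomic.
   Context: An integral domain $D$ is Furstenberg if every nonzero non-unit element of $D$ has an irreducible divisor. An integral domain $D$ is quasi-atomic if for every nonzero non-unit $\alpha\in D$ there exists $\beta\in D$ such that $\alpha\beta$ is a (finite) product of irreducible elements. *)

theory Defs
  imports "HOL-Algebra.Ring_Divisibility"
begin

locale furstenberg_domain = domain +
  assumes irreducible_divisor_exists:
    "\<lbrakk>a \<in> carrier R; a \<noteq> \<zero>; a \<notin> Units R\<rbrakk>
      \<Longrightarrow> \<exists>p \<in> carrier R. ring_irreducible p \<and> p divides a"

text \<open>
  \<^const>\<open>ring_irreducible\<close> does not itself require membership in the carrier, hence the
  explicit side conditions.
\<close>

locale quasi_atomic_domain = domain +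
  assumes atomic_multiple_exists:
    "\<lbrakk>a \<in> carrier R; a \<noteq> \<zero>; a \<notin> Units R\<rbrakk>
      \<Longrightarrow> \<exists>b \<in> carrier R. \<exists>ps. set ps \<subseteq> carrier R \<and> (\<forall>p \<in> set ps. ring_irreducible p)
            \<and> a \<otimes> b = foldr (\<otimes>) ps \<one>"

end

theory Submission
  imports Defs "HOL-Algebra.Weak_Morphisms" "HOL-Library.Countable"
    "HOL-Computational_Algebra.Polynomial"
    "HOL-Computational_Algebra.Primes"
begin

text \<open>
  Take the ring of all rational polynomials whose constant term is an integer. Every
  polynomial whose constant term is not \<open>\<plusminus>1\<close> is divisible by a prime number, which stays irreducible;
  if the constant term is \<open>\<plusminus>1\<close>, a nonunit divisor of least degree with such a constant term is
  irreducible. So the ring is Furstenberg. A polynomial with constant term \<open>0\<close> is divisible by \<open>2\<close> but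
  not associated to it, so irreducible elements have nonzero constant term, and so do their products:
  no multiple of \<open>X\<close> is such a product.
\<close>

section \<open>Invariance under isomorphism\<close>

lemma ring_iso_Units:
  assumes "h \<in> ring_iso R S" "x \<in> Units R"
  shows "h x \<in> Units S"
proof -
  note hE = ring_iso_memE[OF assms(1)]
  obtain y where y: "y \<in> carrier R" "y \<otimes>\<^bsub>R\<^esub> x = \<one>\<^bsub>R\<^esub>" "x \<otimes>\<^bsub>R\<^esub> y = \<one>\<^bsub>R\<^esub>" and x: "x \<in> carrier R"
    using assms(2) by (auto simp: Units_def)
  have "h y \<otimes>\<^bsub>S\<^esub> h x = \<one>\<^bsub>S\<^esub>" "h x \<otimes>\<^bsub>S\<^esub> h y = \<one>\<^bsub>S\<^esub>"
    using hE(2)[OF y(1) x] hE(2)[OF x y(1)] y hE(4) by simp_all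
  then show ?thesis
    using hE(1) x y(1) by (auto simp: Units_def)
qed

lemma ring_iso_Units_iff:
  assumes "ring R" "h \<in> ring_iso R S" "x \<in> carrier R"
  shows "h x \<in> Units S \<longleftrightarrow> x \<in> Units R"
proof
  assume "h x \<in> Units S"
  then have "inv_into (carrier R) h (h x) \<in> Units R"
    by (rule ring_iso_Units[OF ring_iso_set_sym[OF assms(1,2)]])
  then show "x \<in> Units R"
    using assms(3) ring_iso_memE(5)[OF assms(2)] by (simp add: bij_betw_def)
qed (rule ring_iso_Units[OF assms(2)])

text \<open>A factorization of \<open>h p\<close> in \<open>S\<close> pulls back to one of
  \<open>p\<close> in \<open>R\<close>: surjectivity lifts the two factors, injectivity lifts the
  equation, and units are preserved by \<open>h\<close>.\<close>

lemma ring_iso_ring_irreducible: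
  assumes "domain R" "domain S" and h: "h \<in> ring_iso R S"
    and p: "p \<in> carrier R" "ring_irreducible\<^bsub>R\<^esub> p"
  shows "ring_irreducible\<^bsub>S\<^esub> (h p)"
proof -
  interpret R: domain R by fact
  interpret S: domain S by fact
  note hE = ring_iso_memE[OF h]
  have inj: "inj_on h (carrier R)" and img: "h ` carrier R = carrier S"
    using hE(5) by (auto simp: bij_betw_def)
  have zero: "h \<zero>\<^bsub>R\<^esub> = \<zero>\<^bsub>S\<^esub>"
    using ring_hom_zero[of h R S] h R.ring_axioms S.ring_axioms by (simp add: ring_iso_def)
  show ?thesis
  proof (rule S.ring_irreducibleI)
    show "h p \<in> carrier S - {\<zero>\<^bsub>S\<^esub>}"
      using hE(1) p inj zero R.ring_irreducibleE(1)[OF p]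
      by (metis DiffI R.zero_closed inj_on_eq_iff singletonD)
    show "h p \<notin> Units S"
      using ring_iso_Units_iff[OF R.ring_axioms h p(1)] R.ring_irreducibleE(4)[OF p] by simp
    fix a b assume ab: "a \<in> carrier S" "b \<in> carrier S" "h p = a \<otimes>\<^bsub>S\<^esub> b"
    then obtain a' b' where a': "a' \<in> carrier R" "a = h a'" and b': "b' \<in> carrier R" "b = h b'"
      using img by blast
    then have "p = a' \<otimes>\<^bsub>R\<^esub> b'"
      using ab(3) hE(2) inj p(1) by (metis R.m_closed inj_on_eq_iff)
    then show "a \<in> Units S \<or> b \<in> Units S"
      using R.ring_irreducibleE(5)[OF p a'(1) b'(1)] ring_iso_Units[OF h] a' b' by auto
  qed
qed

text \<open>Serves to carry the property from the concrete polynomial ring to a copy of it on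
  \<open>nat\<close>.\<close>

lemma ring_iso_furstenberg_domain:
  assumes "furstenberg_domain R" "domain S" and h: "h \<in> ring_iso R S"
  shows "furstenberg_domain S"
proof -
  interpret R: furstenberg_domain R by fact
  interpret S: domain S by fact
  note hE = ring_iso_memE[OF h]
  have zero: "h \<zero>\<^bsub>R\<^esub> = \<zero>\<^bsub>S\<^esub>"
    using ring_hom_zero[of h R S] h R.ring_axioms S.ring_axioms by (simp add: ring_iso_def)
  show ?thesis
  proof
    fix a assume a: "a \<in> carrier S" "a \<noteq> \<zero>\<^bsub>S\<^esub>" "a \<notin> Units S"
    then obtain a' where a': "a' \<in> carrier R" "a = h a'"
      using hE(5) by (auto simp: bij_betw_def)
    then have "a' \<noteq> \<zero>\<^bsub>R\<^esub>" "a' \<notin> Units R"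
      using a zero ring_iso_Units[OF h] by auto
    then obtain p c where p: "p \<in> carrier R" "ring_irreducible\<^bsub>R\<^esub> p"
      and c: "c \<in> carrier R" "a' = p \<otimes>\<^bsub>R\<^esub> c"
      using R.irreducible_divisor_exists[OF a'(1)] by (auto simp: factor_def)
    have "h p divides\<^bsub>S\<^esub> a"
      using hE(1,2) p(1) c a'(2) by (auto simp: factor_def)
    then show "\<exists>p\<in>carrier S. ring_irreducible\<^bsub>S\<^esub> p \<and> p divides\<^bsub>S\<^esub> a"
      using hE(1)[OF p(1)] ring_iso_ring_irreducible[OF R.domain_axioms S.domain_axioms h p] by blast
  qed
qed

lemma ring_iso_foldr_mult:
  assumes "ring R" and h: "h \<in> ring_iso R S" and "set ps \<subseteq> carrier R"
  shows "h (foldr (\<otimes>\<^bsub>R\<^esub>) ps \<one>\<^bsub>R\<^esub>) = foldr (\<otimes>\<^bsub>S\<^esub>) (map h ps) \<one>\<^bsub>S\<^esub>"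
  using assms(3)
proof (induction ps)
  case (Cons p ps)
  interpret R: ring R by fact
  \<comment> \<open>\<open>h\<close> is known to be multiplicative only on the carrier, so the tail
    product has to lie there.\<close>
  have "foldr (\<otimes>\<^bsub>R\<^esub>) ps \<one>\<^bsub>R\<^esub> \<in> carrier R"
    using Cons.prems by (induction ps) auto
  then show ?case
    using Cons ring_iso_memE(2)[OF h] by simp
qed (simp add: ring_iso_memE(4)[OF h])

text \<open>Used backwards: along the inverse isomorphism, it moves the failure of quasi-atomicity
  from the polynomials to the copy.\<close>

lemma ring_iso_quasi_atomic_domain:
  assumes "quasi_atomic_domain R" "domain S" and h: "h \<in> ring_iso R S"
  shows "quasi_atomic_domain S"
proof -
  interpret R: quasi_atomic_domain R by fact
  interpret S: domain S by fact
  note hE = ring_iso_memE[OF h]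
  have zero: "h \<zero>\<^bsub>R\<^esub> = \<zero>\<^bsub>S\<^esub>"
    using ring_hom_zero[of h R S] h R.ring_axioms S.ring_axioms by (simp add: ring_iso_def)
  show ?thesis
  proof
    fix a assume a: "a \<in> carrier S" "a \<noteq> \<zero>\<^bsub>S\<^esub>" "a \<notin> Units S"
    then obtain a' where a': "a' \<in> carrier R" "a = h a'"
      using hE(5) by (auto simp: bij_betw_def)
    then have "a' \<noteq> \<zero>\<^bsub>R\<^esub>" "a' \<notin> Units R"
      using a zero ring_iso_Units[OF h] by auto
    then obtain b ps where b: "b \<in> carrier R"
      and ps: "set ps \<subseteq> carrier R" "\<forall>p\<in>set ps. ring_irreducible\<^bsub>R\<^esub> p"
      and eq: "a' \<otimes>\<^bsub>R\<^esub> b = foldr (\<otimes>\<^bsub>R\<^esub>) ps \<one>\<^bsub>R\<^esub>"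
      using R.atomic_multiple_exists[OF a'(1)] by blast
    have "a \<otimes>\<^bsub>S\<^esub> h b = foldr (\<otimes>\<^bsub>S\<^esub>) (map h ps) \<one>\<^bsub>S\<^esub>"
      using ring_iso_foldr_mult[OF R.ring_axioms h ps(1)] hE(2)[OF a'(1) b] eq a'(2) by simp
    moreover have "\<forall>p\<in>set (map h ps). ring_irreducible\<^bsub>S\<^esub> p"
      using ring_iso_ring_irreducible[OF R.domain_axioms S.domain_axioms h] ps by auto
    moreover have "set (map h ps) \<subseteq> carrier S"
      using hE(1) ps(1) by auto
    ultimately show "\<exists>b\<in>carrier S. \<exists>ps. set ps \<subseteq> carrier S
        \<and> (\<forall>p\<in>set ps. ring_irreducible\<^bsub>S\<^esub> p) \<and> a \<otimes>\<^bsub>S\<^esub> b = foldr (\<otimes>\<^bsub>S\<^esub>) ps \<one>\<^bsub>S\<^esub>"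
      using hE(1)[OF b] by blast
  qed
qed

section \<open>Rational polynomials with integral constant term\<close>

text \<open>This is Z + X Q[X]. The constant term is written \<open>poly f 0\<close> because
  evaluation at 0 respects sums and products, which gives closure of the carrier at once.\<close>

definition int_const_poly_ring :: "rat poly ring"
  where "int_const_poly_ring =
    \<lparr>carrier = {f. poly f 0 \<in> \<int>}, monoid.mult = (*), one = 1, zero = 0, add = (+)\<rparr>"

lemma int_const_poly_ring_simps [simp]:
  "carrier int_const_poly_ring = {f. poly f 0 \<in> \<int>}"
  "f \<otimes>\<^bsub>int_const_poly_ring\<^esub> g = f * g"
  "\<one>\<^bsub>int_const_poly_ring\<^esub> = 1"
  "f \<oplus>\<^bsub>int_const_poly_ring\<^esub> g = f + g"
  "\<zero>\<^bsub>int_const_poly_ring\<^esub> = 0"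
  by (simp_all add: int_const_poly_ring_def)

lemma domain_int_const_poly_ring: "domain int_const_poly_ring"
proof (rule domainI)
  show "cring int_const_poly_ring"
  proof (rule cringI)
    show "abelian_group int_const_poly_ring"
    proof (rule abelian_groupI)
      fix f assume "f \<in> carrier int_const_poly_ring"
      then show "\<exists>g\<in>carrier int_const_poly_ring. g \<oplus>\<^bsub>int_const_poly_ring\<^esub> f = \<zero>\<^bsub>int_const_poly_ring\<^esub>"
        by (intro bexI[of _ "- f"]) auto
    qed auto
    show "comm_monoid int_const_poly_ring"
      by (rule comm_monoidI) auto
  qed (auto simp: algebra_simps)
qed auto

section \<open>Units and irreducible constants\<close>

text \<open>Degrees add under multiplication, so a unit is constant; evaluating
  \<open>f * g = 1\<close> at 0 then leaves an equation \<open>m * n = 1\<close> in the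
  integers.\<close>

lemma Units_int_const_poly_ring: "Units int_const_poly_ring = {1, -1}"
proof
  show "Units int_const_poly_ring \<subseteq> {1, -1}"
  proof
    fix f assume "f \<in> Units int_const_poly_ring"
    then obtain g where f: "poly f 0 \<in> \<int>" and g: "poly g 0 \<in> \<int>" and fg: "f * g = 1"
      by (auto simp: Units_def mult.commute)
    then have "f \<noteq> 0" "g \<noteq> 0"
      by auto
    then have "degree f = 0"
      using fg degree_mult_eq[of f g] by simp
    then obtain c where c: "f = [:c:]"
      by (rule degree_eq_zeroE)
    obtain m n where mn: "poly f 0 = of_int m" "poly g 0 = of_int n"
      using f g by (auto elim!: Ints_cases)
    have "(of_int (m * n) :: rat) = poly (f * g) 0"
      using mn by simp
    then have "m * n = 1"
      unfolding fg by (simp flip: of_int_mult)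
    then have "m = 1 \<or> m = -1"
      by (metis zmult_eq_1_iff)
    then show "f \<in> {1, -1}"
      using c mn(1) by (auto simp: one_pCons)
  qed
qed (auto simp: Units_def)

text \<open>By degrees, both factors of a nonzero constant are constants, hence integers, so the
  factorization already takes place in Z.\<close>

lemma ring_irreducible_int_prime:
  fixes p :: int
  assumes "Factorial_Ring.prime p"
  shows "ring_irreducible\<^bsub>int_const_poly_ring\<^esub> [:of_int p:]"
proof -
  interpret domain int_const_poly_ring by (rule domain_int_const_poly_ring)
  have p: "p > 1"
    using assms by (simp add: prime_gt_1_int)
  show ?thesis
  proof (rule ring_irreducibleI)
    show "[:of_int p:] \<in> carrier int_const_poly_ring - {\<zero>\<^bsub>int_const_poly_ring\<^esub>}"
      using p by simp
    show "[:of_int p:] \<notin> Units int_const_poly_ring"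
      using p by (simp add: Units_int_const_poly_ring one_pCons)
    fix f g
    assume "f \<in> carrier int_const_poly_ring" "g \<in> carrier int_const_poly_ring"
      and "[:of_int p:] = f \<otimes>\<^bsub>int_const_poly_ring\<^esub> g"
    then have f: "poly f 0 \<in> \<int>" and g: "poly g 0 \<in> \<int>" and fg: "f * g = [:of_int p:]"
      by auto
    then have "f \<noteq> 0" "g \<noteq> 0"
      using p by auto
    then have deg: "degree f = 0" "degree g = 0"
      using fg degree_mult_eq[of f g] by simp_all
    obtain m n where mn: "poly f 0 = of_int m" "poly g 0 = of_int n"
      using f g by (auto elim!: Ints_cases)
    have "(of_int (m * n) :: rat) = poly (f * g) 0"
      using mn by simp
    then have "p = m * n"
      unfolding fg by (simp flip: of_int_mult)
    then have "is_unit m \<or> is_unit n"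
      using assms by (metis Factorial_Ring.irreducibleD prime_elem_imp_irreducible prime_imp_prime_elem)
    moreover have "f = [:of_int m:]" "g = [:of_int n:]"
      using deg mn by (auto elim!: degree_eq_zeroE)
    ultimately show "f \<in> Units int_const_poly_ring \<or> g \<in> Units int_const_poly_ring"
      by (auto simp: Units_int_const_poly_ring one_pCons zdvd1_eq abs_if split: if_splits)
  qed
qed

section \<open>The Furstenberg property\<close>

text \<open>The cofactor \<open>f / k\<close> has constant term \<open>n\<close>, and its other
  coefficients may be any rationals. The case \<open>n = 0\<close> is included.\<close>

lemma int_divides_of_const_term:
  fixes f :: "rat poly"
  assumes "poly f 0 = of_int (k * n)" "k \<noteq> 0"
  shows "[:of_int k:] divides\<^bsub>int_const_poly_ring\<^esub> f"
  unfolding factor_def using assms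
  by (intro bexI[of _ "smult (inverse (of_int k)) f"]) (auto simp flip: mult.assoc)

text \<open>Descent on the degree: in a proper factorization both constant terms are again 1 or -1,
  so neither nonunit factor is constant and each has smaller degree than \<open>f\<close>.\<close>

lemma irreducible_divisor_const_term_pm1:
  assumes "poly f 0 = 1 \<or> poly f 0 = -1" "f \<notin> Units int_const_poly_ring"
  shows "\<exists>p\<in>carrier int_const_poly_ring.
    ring_irreducible\<^bsub>int_const_poly_ring\<^esub> p \<and> p divides\<^bsub>int_const_poly_ring\<^esub> f"
  using assms
proof (induction "degree f" arbitrary: f rule: less_induct)
  case less
  interpret domain int_const_poly_ring by (rule domain_int_const_poly_ring)
  have f: "f \<in> carrier int_const_poly_ring"
    using less.prems(1) by auto
  show ?case
  proof (cases "ring_irreducible\<^bsub>int_const_poly_ring\<^esub> f")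
    case True
    then show ?thesis
      using f divides_refl by blast
  next
    case False
    have f0: "f \<in> carrier int_const_poly_ring - {\<zero>\<^bsub>int_const_poly_ring\<^esub>}"
      using f less.prems(1) by auto
    from False obtain a b where ab: "a \<in> carrier int_const_poly_ring" "b \<in> carrier int_const_poly_ring"
      "f = a * b" "a \<notin> Units int_const_poly_ring" "b \<notin> Units int_const_poly_ring"
      using ring_irreducibleI[OF f0 less.prems(2)] by (metis int_const_poly_ring_simps(2))
    obtain m n where mn: "poly a 0 = of_int m" "poly b 0 = of_int n"
      using ab by (auto elim!: Ints_cases)
    \<comment> \<open>Writing -1 as \<open>of_int (-1)\<close> lets injectivity of
      \<open>of_int\<close> bring both cases down to the integers.\<close>
    have "(of_int (m * n) :: rat) = 1 \<or> (of_int (m * n) :: rat) = of_int (-1)"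
      using less.prems(1) mn ab(3) by simp
    then have "m * n = 1 \<or> m * n = -1"
      unfolding of_int_eq_iff of_int_eq_1_iff .
    then have "\<bar>m\<bar> = 1" "\<bar>n\<bar> = 1"
      by (metis abs_minus_cancel abs_one abs_zmult_eq_1 mult.commute)+
    then have const: "poly a 0 = 1 \<or> poly a 0 = -1" "poly b 0 = 1 \<or> poly b 0 = -1"
      using mn by (auto simp: abs_if split: if_splits)
    \<comment> \<open>A constant \<open>b\<close> would equal 1 or -1 and thus be a unit.\<close>
    have "degree b \<noteq> 0"
    proof
      assume "degree b = 0"
      then obtain c where "b = [:c:]"
        by (rule degree_eq_zeroE)
      then show False
        using const(2) ab(5) by (auto simp: Units_int_const_poly_ring one_pCons)
    qed
    moreover have "a \<noteq> 0" "b \<noteq> 0"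
      using const by auto
    ultimately have "degree a < degree f"
      using ab(3) by (simp add: degree_mult_eq)
    then obtain p where "p \<in> carrier int_const_poly_ring"
      "ring_irreducible\<^bsub>int_const_poly_ring\<^esub> p" "p divides\<^bsub>int_const_poly_ring\<^esub> a"
      using less.hyps[OF _ const(1) ab(4)] by blast
    moreover have "a divides\<^bsub>int_const_poly_ring\<^esub> f"
      using ab by (auto simp: factor_def)
    ultimately show ?thesis
      using divides_trans by blast
  qed
qed

lemma furstenberg_domain_int_const_poly_ring: "furstenberg_domain int_const_poly_ring"
proof -
  interpret domain int_const_poly_ring by (rule domain_int_const_poly_ring)
  show ?thesis
  proof
    fix f assume f: "f \<in> carrier int_const_poly_ring" "f \<notin> Units int_const_poly_ring"
    then obtain m where m: "poly f 0 = of_int m"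
      by (auto elim!: Ints_cases)
    show "\<exists>p\<in>carrier int_const_poly_ring.
        ring_irreducible\<^bsub>int_const_poly_ring\<^esub> p \<and> p divides\<^bsub>int_const_poly_ring\<^esub> f"
    proof (cases "\<bar>m\<bar> = 1")
      case True
      then have "poly f 0 = 1 \<or> poly f 0 = -1"
        using m by (auto simp: abs_if split: if_splits)
      then show ?thesis
        using irreducible_divisor_const_term_pm1 f(2) by blast
    next
      case False
      \<comment> \<open>Every prime divides 0, so 2 serves there; a nonzero \<open>m\<close> other
        than 1 and -1 has a prime divisor.\<close>
      have "\<exists>q::int. Factorial_Ring.prime q \<and> q dvd m"
      proof (cases "m = 0")
        case True
        then show ?thesis
          by (intro exI[of _ 2]) simp
      next
        case m0: False
        then show ?thesis
          using prime_divisor_exists[of m] False by (auto simp: zdvd1_eq)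
      qed
      then obtain q n where q: "Factorial_Ring.prime q" and n: "m = q * n"
        by (auto elim: dvdE)
      then have "[:of_int q:] divides\<^bsub>int_const_poly_ring\<^esub> f"
        using int_divides_of_const_term[of f q n] m by auto
      then show ?thesis
        using ring_irreducible_int_prime[OF q] by (intro bexI[of _ "[:of_int q:]"]) auto
    qed
  qed
qed

section \<open>Failure of quasi-atomicity\<close>

text \<open>If the constant term is 0, halving \<open>f\<close> stays in the ring, and
  \<open>f = 2 * (f / 2)\<close> has two nonunit factors: 2 is not 1 or -1, and \<open>f / 2\<close>
  vanishes at 0.\<close>

lemma ring_irreducible_const_term_nonzero:
  assumes "f \<in> carrier int_const_poly_ring" "ring_irreducible\<^bsub>int_const_poly_ring\<^esub> f"
  shows "poly f 0 \<noteq> 0"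
proof
  interpret domain int_const_poly_ring by (rule domain_int_const_poly_ring)
  assume f0: "poly f 0 = 0"
  then have "f = [:2:] \<otimes>\<^bsub>int_const_poly_ring\<^esub> smult (1/2) f"
    by simp
  then have "[:2:] \<in> Units int_const_poly_ring \<or> smult (1/2) f \<in> Units int_const_poly_ring"
    using f0 by (intro ring_irreducibleE(5)[OF assms]) auto
  moreover have "[:2:] \<notin> Units int_const_poly_ring"
    by (simp add: Units_int_const_poly_ring one_pCons)
  moreover have "poly (smult (1/2) f) 0 = 0"
    using f0 by simp
  then have "smult (1/2) f \<notin> Units int_const_poly_ring"
    by (auto simp: Units_int_const_poly_ring simp del: poly_smult)
  ultimately show False
    by blast
qed

lemma not_quasi_atomic_domain_int_const_poly_ring: "\<not> quasi_atomic_domain int_const_poly_ring"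
proof
  assume "quasi_atomic_domain int_const_poly_ring"
  then interpret quasi_atomic_domain int_const_poly_ring .
  \<comment> \<open>Evaluation at 0 is multiplicative, and the empty product has value 1. Every
    multiple of X, in contrast, vanishes at 0.\<close>
  have nonzero: "poly (foldr (\<otimes>\<^bsub>int_const_poly_ring\<^esub>) ps \<one>\<^bsub>int_const_poly_ring\<^esub>) 0 \<noteq> 0"
    if "set ps \<subseteq> carrier int_const_poly_ring" "\<forall>p\<in>set ps. ring_irreducible\<^bsub>int_const_poly_ring\<^esub> p"
    for ps
    using that by (induction ps) (use ring_irreducible_const_term_nonzero in auto)
  have "[:0, 1:] \<notin> Units int_const_poly_ring"
    by (simp add: Units_int_const_poly_ring one_pCons)
  then obtain b ps where "set ps \<subseteq> carrier int_const_poly_ring"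
      "\<forall>p\<in>set ps. ring_irreducible\<^bsub>int_const_poly_ring\<^esub> p"
      "[:0, 1:] * b = foldr (\<otimes>\<^bsub>int_const_poly_ring\<^esub>) ps \<one>\<^bsub>int_const_poly_ring\<^esub>"
    using atomic_multiple_exists[of "[:0, 1:]"] by auto
  then show False
    using nonzero[of ps] by (metis mult_zero_left poly_mult poly_pCons add_0)
qed

section \<open>Transport to a ring on the natural numbers\<close>

theorem lemma25:
  shows "\<exists>D :: nat ring. domain D \<and> furstenberg_domain D \<and> \<not> quasi_atomic_domain D"
proof -
  \<comment> \<open>A polynomial is determined by its coefficient list, and lists of rationals are
    countable, so \<open>h\<close> is injective and \<open>image_ring\<close> yields an isomorphic
    copy.\<close>
  define h :: "rat poly \<Rightarrow> nat" where "h = (\<lambda>f. to_nat (coeffs f))"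
  define D where "D = image_ring h int_const_poly_ring"
  interpret R: domain int_const_poly_ring by (rule domain_int_const_poly_ring)
  have inj: "inj_on h (carrier int_const_poly_ring)"
    by (auto simp: h_def inj_on_def coeffs_eq_iff)
  have h: "h \<in> ring_iso int_const_poly_ring D"
    unfolding D_def by (rule inj_imp_image_ring_iso[OF inj])
  have D: "domain D"
    unfolding D_def by (rule R.inj_imp_image_ring_is_domain[OF inj])
  have "furstenberg_domain D"
    using ring_iso_furstenberg_domain[OF furstenberg_domain_int_const_poly_ring D h] .
  moreover have "\<not> quasi_atomic_domain D"
    using ring_iso_quasi_atomic_domain[OF _ domain_int_const_poly_ring ring_iso_set_sym[OF R.ring_axioms h]]
      not_quasi_atomic_domain_int_const_poly_ring by blast
  ultimately show ?thesis
    using D by blast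
qed

end
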